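(* Let $M=\max\{\mu+\theta_s,\theta_q\}$. For any integer $K$ with $m\le K\le N$: 1. if $c_q\theta_q\ge c_s\theta_s>0$, the cutoff-static policy $\pi_K^{\hat\delta}$ satisfies $$\mathbf C(\pi_K^{\hat\delta})\le\mathbf C(\vec\lambda^* )\times\max_{\delta\in[0,\Lambda]}\left(\frac{\sum_{n=1}^K nP_n(\pi_K^\delta)}{\delta/M}+\frac{c_q\theta_q-c_s\theta_s}{c_h+c_s\theta_s}\times\frac{\sum_{n=m+1}^K nP_n(\pi_K^\delta)}{\delta/M}\right);$$ 2. if $c_s\theta_s\ge c_q\theta_q>0$, the cutoff-static policy $\pi_K^{\hat\delta}$ satisfies $$\mathbf C(\pi_K^{\hat\delta})\le\mathbf C(\vec\lambda^* )\times\max_{\delta\in[0,\Lambda]}\left(\frac{\sum_{n=1}^K nP_n(\pi_K^\delta)}{\delta/M}+\frac{c_s\theta_s-c_q\theta_q}{c_h+c_q\theta_q}\times\frac{\sum_{n=1}^K\min\{n,m\}P_n(\pi_K^\delta)}{\delta/M}\right).$$ Here the expressions being maximized are understood at $\delta=0$ as their limits as $\delta\downarrow0$.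
   Context: Model: a Markovian queue with $m$ servers, capacity $N$, maximal arrival rate $\Lambda$, service rate $\mu$, abandonment rates $\theta_s$ (in service) and $\theta_q$ (waiting), holding cost $c_h$, abandonment costs $c_s$ (in service) and $c_q$ (waiting). The parameters are integers $1\le m\le N<\infty$ and reals $\Lambda>0$, $\mu>0$, $\theta_q>0$, $\theta_s\ge 0$, $c_h,c_q,c_s\ge 0$, $0\le a<b<\infty$. $F$ is a continuous cumulative distribution function supported on $[a,b]$ ($F(a)=0$, $F(b)=1$) with a positive density on $[a,b]$; $\bar F=1-F$, and for $y\in[0,1]$, $\bar F^{-1}(y)=\inf\{x\in[a,b]:\bar F(x)\le y\}$. Death rates: $\gamma_n=\min\{n,m\}(\mu+\theta_s)+\max\{n-m,0\}\theta_q$. The time unit is scaled so that $\Lambda+m(\mu+\theta_s)+(N-m)\theta_q=1$. Markov decision process: states $\{0,\ldots,N\}$; actions $A_n=[0,\Lambda]$ for $n<N$ and $A_N=\{0\}$; rewards $r_n(\lambda)=\lambda\bar F^{-1}(\lambda/\Lambda)-nc_h-\min\{n,m\}c_s\theta_s-\max\{n-m,0\}c_q\theta_q$; transition probabilities $\mathbf P(n+1|n,\lambda)=\lambda$ for $n\le N-1$, $\mathbf P(n-1|n,\lambda)=\gamma_n$ for $n\ge1$, $\mathbf P(n|n,\lambda)=1-\lambda-\gamma_n$, and $0$ otherwise. Let $g^*\in\mathbb R$ and $h:\{0,\ldots,N\}\to\mathbb R$ solve the Bellman equations $g^*+h(n)=\max_{\lambda\in A_n}\{r_n(\lambda)+\sum_{j=0}^N\mathbf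 P(j|n,\lambda)h(j)\}$, $n=0,\ldots,N$. The optimal arrival rate policy $\vec\lambda^*=(\lambda^*_0,\ldots,\lambda^*_N)$ is $\lambda_n^*=\inf(\arg\max_{\lambda\in A_n}\{r_n(\lambda)+\sum_{j=0}^N\mathbf P(j|n,\lambda)h(j)\})$. Policies: an arrival rate policy is $\vec\lambda\in\Pi=[0,\Lambda]^N\times\{0\}$. Its steady-state probabilities are $P_n(\vec\lambda)=a_n(\vec\lambda)/\sum_{i=0}^N a_i(\vec\lambda)$ with $a_0(\vec\lambda)=1$, $a_n(\vec\lambda)=\prod_{i=1}^n\lambda_{i-1}/\gamma_i$. Long-run average total cost: $\mathbf C(\vec\lambda)=\sum_{n=1}^N(nc_h+\min\{n,m\}c_s\theta_s+\max\{n-m,0\}c_q\theta_q)P_n(\vec\lambda)$. Effective arrival rate under the optimal policy: $\hat\delta=\sum_{n=0}^N\lambda_n^*P_n(\vec\lambda^* )$. Cutoff-static policy: for $K\in\{0,\ldots,N\}$ and $\delta\in[0,\Lambda]$, $\pi_K^\delta\in\Pi$ has arrival rate $\delta$ in states $0\le n<K$ and $0$ in states $K\le n\le N$. *)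

theory Defs
  imports "HOL-Probability.Distribution_Functions"
begin

text \<open>Parameters of the queue: \<open>m\<close> servers, capacity \<open>N\<close>, maximal arrival rate \<open>\<Lambda>\<close>, service rate \<open>\<mu>\<close>,
  abandonment rates \<open>\<theta>\<^sub>s\<close> (in service) and \<open>\<theta>\<^sub>q\<close> (waiting), holding cost \<open>c\<^sub>h\<close>,
  abandonment costs \<open>c\<^sub>s\<close> (in service) and \<open>c\<^sub>q\<close> (waiting), and the valuation distribution
  function \<open>F\<close> on \<open>[a, b]\<close>, in this order.\<close>

record queue =
  servers :: nat
  capacity :: nat
  max_arrival :: real
  service_rate :: real
  aban_rate_s :: real
  aban_rate_q :: real
  hold_cost :: real
  aban_cost_s :: real
  aban_cost_q :: real
  val_low :: real
  val_high :: real
  val_cdf :: "real \<Rightarrow> real"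

text \<open>Positivity everywhere on \<open>[a, b]\<close> is no restriction compared with positivity
  almost everywhere, as a density may be changed on a null set.\<close>

definition valuation_cdf :: "real \<Rightarrow> real \<Rightarrow> (real \<Rightarrow> real) \<Rightarrow> bool" where
  "valuation_cdf a b F \<longleftrightarrow>
     continuous_on UNIV F \<and> F a = 0 \<and> F b = 1 \<and>
     (\<exists>f. f \<in> borel_measurable borel \<and> (\<forall>x. 0 \<le> f x) \<and> (\<forall>x\<in>{a..b}. 0 < f x) \<and>
          prob_space (density lborel (\<lambda>x. ennreal (f x))) \<and>
          F = cdf (density lborel (\<lambda>x. ennreal (f x))))"

text \<open>The last clause is the choice of the time unit (uniformization).\<close>

definition valid_queue :: "queue \<Rightarrow> bool" where
  "valid_queue Q \<longleftrightarrow>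
     1 \<le> servers Q \<and> servers Q \<le> capacity Q \<and>
     0 < max_arrival Q \<and> 0 < service_rate Q \<and>
     0 \<le> aban_rate_s Q \<and> 0 < aban_rate_q Q \<and>
     0 \<le> hold_cost Q \<and> 0 \<le> aban_cost_s Q \<and> 0 \<le> aban_cost_q Q \<and>
     0 \<le> val_low Q \<and> val_low Q < val_high Q \<and>
     valuation_cdf (val_low Q) (val_high Q) (val_cdf Q) \<and>
     max_arrival Q + real (servers Q) * (service_rate Q + aban_rate_s Q)
       + (real (capacity Q) - real (servers Q)) * aban_rate_q Q = 1"

definition Fbar_inv :: "queue \<Rightarrow> real \<Rightarrow> real" where
  "Fbar_inv Q y = Inf {x \<in> {val_low Q..val_high Q}. 1 - val_cdf Q x \<le> y}"

definition death_rate :: "queue \<Rightarrow> nat \<Rightarrow> real" where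
  "death_rate Q n = real (min n (servers Q)) * (service_rate Q + aban_rate_s Q)
     + max (real n - real (servers Q)) 0 * aban_rate_q Q"

definition state_cost :: "queue \<Rightarrow> nat \<Rightarrow> real" where
  "state_cost Q n = real n * hold_cost Q
     + real (min n (servers Q)) * aban_cost_s Q * aban_rate_s Q
     + max (real n - real (servers Q)) 0 * aban_cost_q Q * aban_rate_q Q"

subsection \<open>The Markov decision process\<close>

definition actions :: "queue \<Rightarrow> nat \<Rightarrow> real set" where
  "actions Q n = (if n < capacity Q then {0..max_arrival Q} else {0})"

definition reward :: "queue \<Rightarrow> nat \<Rightarrow> real \<Rightarrow> real" where
  "reward Q n l = l * Fbar_inv Q (l / max_arrival Q) - state_cost Q n"

text \<open>\<open>trans_prob Q j n l\<close> is the probability of moving to \<open>j\<close> from \<open>n\<close> under action \<open>l\<close>.\<close>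

definition trans_prob :: "queue \<Rightarrow> nat \<Rightarrow> nat \<Rightarrow> real \<Rightarrow> real" where
  "trans_prob Q j n l =
     (if n < capacity Q \<and> j = n + 1 then l
      else if 1 \<le> n \<and> j = n - 1 then death_rate Q n
      else if j = n then 1 - l - death_rate Q n
      else 0)"

definition action_value :: "queue \<Rightarrow> (nat \<Rightarrow> real) \<Rightarrow> nat \<Rightarrow> real \<Rightarrow> real" where
  "action_value Q h n l = reward Q n l + (\<Sum>j = 0..capacity Q. trans_prob Q j n l * h j)"

text \<open>\<open>v\<close> is the attained maximum of \<open>f\<close> over \<open>S\<close>.\<close>

definition has_max_on :: "('a \<Rightarrow> real) \<Rightarrow> 'a set \<Rightarrow> real \<Rightarrow> bool" where
  "has_max_on f S v \<longleftrightarrow> (\<exists>x\<in>S. f x = v) \<and> (\<forall>x\<in>S. f x \<le> v)"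

definition bellman_solution :: "queue \<Rightarrow> real \<Rightarrow> (nat \<Rightarrow> real) \<Rightarrow> bool" where
  "bellman_solution Q g h \<longleftrightarrow>
     (\<forall>n\<le>capacity Q. has_max_on (action_value Q h n) (actions Q n) (g + h n))"

definition opt_policy :: "queue \<Rightarrow> (nat \<Rightarrow> real) \<Rightarrow> nat \<Rightarrow> real" where
  "opt_policy Q h n = Inf {l. is_arg_max (action_value Q h n) (\<lambda>x. x \<in> actions Q n) l}"

subsection \<open>Arrival rate policies\<close>

text \<open>A policy is a function \<open>nat \<Rightarrow> real\<close> of which only the values at \<open>0, \<dots>, N\<close> matter.\<close>

definition ss_weight :: "queue \<Rightarrow> (nat \<Rightarrow> real) \<Rightarrow> nat \<Rightarrow> real" where
  "ss_weight Q p n = (\<Prod>i = 1..n. p (i - 1) / death_rate Q i)"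

definition ss_prob :: "queue \<Rightarrow> (nat \<Rightarrow> real) \<Rightarrow> nat \<Rightarrow> real" where
  "ss_prob Q p n = ss_weight Q p n / (\<Sum>i = 0..capacity Q. ss_weight Q p i)"

definition avg_cost :: "queue \<Rightarrow> (nat \<Rightarrow> real) \<Rightarrow> real" where
  "avg_cost Q p = (\<Sum>n = 1..capacity Q. state_cost Q n * ss_prob Q p n)"

definition eff_arrival :: "queue \<Rightarrow> (nat \<Rightarrow> real) \<Rightarrow> real" where
  "eff_arrival Q p = (\<Sum>n = 0..capacity Q. p n * ss_prob Q p n)"

definition cutoff_policy :: "nat \<Rightarrow> real \<Rightarrow> nat \<Rightarrow> real" where
  "cutoff_policy K d n = (if n < K then d else 0)"

definition max_exit_rate :: "queue \<Rightarrow> real" where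
  "max_exit_rate Q = max (service_rate Q + aban_rate_s Q) (aban_rate_q Q)"

text \<open>\<open>v\<close> is the maximum over \<open>[0, u]\<close> of \<open>f\<close>, where the value of \<open>f\<close> at \<open>0\<close>
  is replaced by its right limit there (the existence of which is part of the assertion).\<close>

definition has_max_lim0 :: "(real \<Rightarrow> real) \<Rightarrow> real \<Rightarrow> real \<Rightarrow> bool" where
  "has_max_lim0 f u v \<longleftrightarrow>
     (\<exists>L. (f \<longlongrightarrow> L) (at_right 0) \<and> has_max_on (f(0 := L)) {0..u} v)"

end

theory Submission
  imports Defs
begin

text \<open>
  Let \<open>p\<close> be an arrival rate policy, for instance the optimal one. Its cost is compared with that of
  the cutoff-static policy through a single number, the effective arrival rate of \<open>p\<close>
  (\<open>avg_cost_cutoff_le_mult_max\<close>). Two facts carry the comparison.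

  First, in steady state customers enter as fast as they leave, so the effective arrival rate \<open>d\<close>
  is the mean death rate (\<open>eff_arrival_eq_mean_death_rate\<close>). A customer leaves at rate at most
  \<open>M = max_exit_rate Q\<close>, so the mean number of customers under \<open>p\<close> is at least \<open>d / M\<close>. If
  every customer costs at least \<open>c\<close> per unit of time, the cost of \<open>p\<close> is at least \<open>c * (d / M)\<close>
  (\<open>avg_cost_ge_eff_arrival\<close>).

  Second, if state \<open>n\<close> costs at most \<open>c * w n\<close>, the cost of the cutoff-static policy with arrival
  rate \<open>d\<close> is at most \<open>c\<close> times its mean of \<open>w\<close>. Dividing this mean by \<open>d / M\<close> gives the function
  that is maximized, evaluated at \<open>d\<close>; the maximum exists because the stationary probabilities of
  the nonempty states are divisible by \<open>d\<close> as rational functions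
  (\<open>has_max_lim0_mean_weight\<close>).

  In both cases of the theorem \<open>c\<close> is the holding cost plus the smaller of the two abandonment
  cost rates, and \<open>w n\<close> is \<open>n\<close> plus the excess of the larger rate, relative to \<open>c\<close>, times
  (a bound on) the number of customers who incur it.
\<close>

section \<open>Steady-state probabilities\<close>

lemma death_rate_pos:
  assumes "valid_queue Q" and "1 \<le> n"
  shows "0 < death_rate Q n"
proof -
  have "0 < real (min n (servers Q)) * (service_rate Q + aban_rate_s Q)"
    using assms by (intro mult_pos_pos) (auto simp: valid_queue_def)
  moreover have "0 \<le> max (real n - real (servers Q)) 0 * aban_rate_q Q"
    using assms by (auto simp: valid_queue_def)
  ultimately show ?thesis by (simp add: death_rate_def)
qed

lemma min_plus_excess: "real (min n m) + max (real n - real m) 0 = real n"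
  by (cases "n \<le> m") auto

lemma death_rate_le: "death_rate Q n \<le> real n * max_exit_rate Q"
proof -
  have "death_rate Q n \<le> real (min n (servers Q)) * max_exit_rate Q
      + max (real n - real (servers Q)) 0 * max_exit_rate Q"
    unfolding death_rate_def max_exit_rate_def by (intro add_mono mult_left_mono) auto
  also have "\<dots> = real n * max_exit_rate Q"
    by (simp only: distrib_right [symmetric] min_plus_excess)
  finally show ?thesis .
qed

lemma max_exit_rate_pos: "valid_queue Q \<Longrightarrow> 0 < max_exit_rate Q"
  by (simp add: valid_queue_def max_exit_rate_def less_max_iff_disj)

definition admissible :: "queue \<Rightarrow> (nat \<Rightarrow> real) \<Rightarrow> bool" where
  "admissible Q p \<longleftrightarrow> (\<forall>n\<le>capacity Q. p n \<in> actions Q n)"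

lemma admissible_bounds:
  assumes "valid_queue Q" and "admissible Q p" and "n \<le> capacity Q"
  shows "0 \<le> p n" and "p n \<le> max_arrival Q"
proof -
  have "0 < max_arrival Q" using assms(1) by (simp add: valid_queue_def)
  then show "0 \<le> p n" and "p n \<le> max_arrival Q"
    using assms(2,3) unfolding admissible_def actions_def
    by (fastforce split: if_splits)+
qed

lemma admissible_capacity: "admissible Q p \<Longrightarrow> p (capacity Q) = 0"
  by (auto simp: admissible_def actions_def)

lemma ss_weight_0: "ss_weight Q p 0 = 1"
  by (simp add: ss_weight_def)

lemma ss_weight_Suc:
  "ss_weight Q p (Suc n) = ss_weight Q p n * (p n / death_rate Q (Suc n))"
  by (simp add: ss_weight_def)

lemma ss_weight_nonneg:
  assumes "valid_queue Q" and "admissible Q p" and "n \<le> capacity Q"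
  shows "0 \<le> ss_weight Q p n"
  unfolding ss_weight_def
  by (intro prod_nonneg ballI divide_nonneg_pos admissible_bounds [OF assms(1,2)]
        death_rate_pos [OF assms(1)])
     (use assms(3) in auto)

lemma sum_ss_weight_pos:
  assumes "valid_queue Q" and "admissible Q p"
  shows "0 < (\<Sum>i = 0..capacity Q. ss_weight Q p i)"
  by (rule sum_pos2 [of _ 0]) (auto simp: ss_weight_0 intro: ss_weight_nonneg [OF assms])

lemma ss_prob_nonneg:
  assumes "valid_queue Q" and "admissible Q p" and "n \<le> capacity Q"
  shows "0 \<le> ss_prob Q p n"
  using ss_weight_nonneg [OF assms] sum_ss_weight_pos [OF assms(1,2)]
  by (simp add: ss_prob_def)

lemma sum_ss_prob:
  assumes "valid_queue Q" and "admissible Q p"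
  shows "(\<Sum>n = 0..capacity Q. ss_prob Q p n) = 1"
  using sum_ss_weight_pos [OF assms] by (simp add: ss_prob_def sum_divide_distrib [symmetric])

text \<open>The cut between states \<open>n\<close> and \<open>n + 1\<close> is crossed upwards and downwards equally often.\<close>

lemma detailed_balance:
  assumes "valid_queue Q"
  shows "p n * ss_prob Q p n = death_rate Q (Suc n) * ss_prob Q p (Suc n)"
  using death_rate_pos [OF assms, of "Suc n"] by (simp add: ss_prob_def ss_weight_Suc)

text \<open>Sum the balance equations over all cuts; the full system admits nobody.\<close>

lemma eff_arrival_eq_mean_death_rate:
  assumes "valid_queue Q" and "admissible Q p"
  shows "eff_arrival Q p = (\<Sum>n = 1..capacity Q. death_rate Q n * ss_prob Q p n)"
proof -
  have "eff_arrival Q p = (\<Sum>n<capacity Q. p n * ss_prob Q p n)"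
    using admissible_capacity [OF assms(2)]
    by (simp add: eff_arrival_def atLeast0AtMost lessThan_Suc_atMost [symmetric])
  also have "\<dots> = (\<Sum>n<capacity Q. death_rate Q (Suc n) * ss_prob Q p (Suc n))"
    by (simp only: detailed_balance [OF assms(1)])
  also have "\<dots> = (\<Sum>n = 1..capacity Q. death_rate Q n * ss_prob Q p n)"
    by (rule sum.reindex_bij_witness [of _ "\<lambda>n. n - 1" Suc]) auto
  finally show ?thesis .
qed

lemma eff_arrival_bounds:
  assumes "valid_queue Q" and "admissible Q p"
  shows "0 \<le> eff_arrival Q p" and "eff_arrival Q p \<le> max_arrival Q"
proof -
  show "0 \<le> eff_arrival Q p"
    unfolding eff_arrival_def
    by (intro sum_nonneg mult_nonneg_nonneg admissible_bounds [OF assms] ss_prob_nonneg [OF assms])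
       auto
  have "eff_arrival Q p \<le> (\<Sum>n = 0..capacity Q. max_arrival Q * ss_prob Q p n)"
    unfolding eff_arrival_def
    by (intro sum_mono mult_right_mono admissible_bounds [OF assms] ss_prob_nonneg [OF assms]) auto
  also have "\<dots> = max_arrival Q"
    by (simp add: sum_distrib_left [symmetric] sum_ss_prob [OF assms])
  finally show "eff_arrival Q p \<le> max_arrival Q" .
qed

text \<open>Each customer leaves at rate at most \<open>M\<close>, so by the balance of entries and departures
  there are on average at least \<open>eff_arrival Q p / M\<close> customers, and each of them costs at least
  \<open>c\<close>.\<close>

lemma avg_cost_ge_eff_arrival:
  assumes "valid_queue Q" and "admissible Q p" and "0 \<le> c"
    and "\<And>n. c * real n \<le> state_cost Q n"
  shows "c * (eff_arrival Q p / max_exit_rate Q) \<le> avg_cost Q p"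
proof -
  have "eff_arrival Q p \<le> (\<Sum>n = 1..capacity Q. real n * max_exit_rate Q * ss_prob Q p n)"
    unfolding eff_arrival_eq_mean_death_rate [OF assms(1,2)]
    by (intro sum_mono mult_right_mono death_rate_le ss_prob_nonneg [OF assms(1,2)]) auto
  also have "\<dots> = max_exit_rate Q * (\<Sum>n = 1..capacity Q. real n * ss_prob Q p n)"
    by (simp add: sum_distrib_left mult_ac)
  finally have "eff_arrival Q p / max_exit_rate Q \<le> (\<Sum>n = 1..capacity Q. real n * ss_prob Q p n)"
    using max_exit_rate_pos [OF assms(1)] by (simp add: divide_le_eq mult.commute)
  then have "c * (eff_arrival Q p / max_exit_rate Q)
      \<le> c * (\<Sum>n = 1..capacity Q. real n * ss_prob Q p n)"
    using assms(3) by (rule mult_left_mono)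
  also have "\<dots> = (\<Sum>n = 1..capacity Q. (c * real n) * ss_prob Q p n)"
    by (simp only: sum_distrib_left mult.assoc)
  also have "\<dots> \<le> avg_cost Q p"
    unfolding avg_cost_def
    by (intro sum_mono mult_right_mono assms(4) ss_prob_nonneg [OF assms(1,2)]) auto
  finally show ?thesis .
qed

lemma admissible_opt_policy:
  assumes "valid_queue Q" and "bellman_solution Q g h"
  shows "admissible Q (opt_policy Q h)"
  unfolding admissible_def
proof (intro allI impI)
  fix n assume n: "n \<le> capacity Q"
  let ?A = "{l. is_arg_max (action_value Q h n) (\<lambda>x. x \<in> actions Q n) l}"
  have sub: "?A \<subseteq> actions Q n" by (auto simp: is_arg_max_def)
  obtain l where "l \<in> actions Q n" "\<forall>x\<in>actions Q n. action_value Q h n x \<le> action_value Q h n l"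
    using assms(2) n unfolding bellman_solution_def has_max_on_def by fastforce
  then have "l \<in> ?A"
    by (auto simp: is_arg_max_linorder)
  then have ne: "?A \<noteq> {}" by blast
  have "closed (actions Q n)" "bdd_below (actions Q n)"
    by (auto simp: actions_def)
  \<comment> \<open>The infimum of the maximizers lies in their closure.\<close>
  moreover have "bdd_below ?A"
    using \<open>bdd_below (actions Q n)\<close> sub by (rule bdd_below_mono)
  then have "Inf ?A \<in> closure ?A"
    using ne by (intro closure_contains_Inf)
  ultimately show "opt_policy Q h n \<in> actions Q n"
    unfolding opt_policy_def using closure_minimal [OF sub] by blast
qed

section \<open>Cutoff-static policies\<close>

lemma admissible_cutoff_policy:
  assumes "K \<le> capacity Q" and "0 \<le> d" and "d \<le> max_arrival Q"
  shows "admissible Q (cutoff_policy K d)"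
  using assms by (auto simp: admissible_def actions_def cutoff_policy_def)

lemma ss_weight_cutoff:
  "ss_weight Q (cutoff_policy K d) n
     = (if n \<le> K then d ^ n / (\<Prod>i = 1..n. death_rate Q i) else 0)"
proof (cases "n \<le> K")
  case True
  then have "ss_weight Q (cutoff_policy K d) n = (\<Prod>i = 1..n. d / death_rate Q i)"
    unfolding ss_weight_def by (intro prod.cong) (auto simp: cutoff_policy_def)
  then show ?thesis using True by (simp add: prod_dividef)
next
  case False
  then have "ss_weight Q (cutoff_policy K d) n = 0"
    unfolding ss_weight_def by (intro prod_zero bexI [of _ "Suc K"]) (auto simp: cutoff_policy_def)
  then show ?thesis using False by simp
qed

lemma sum_ss_weight_cutoff:
  assumes "K \<le> capacity Q"
  shows "(\<Sum>i = 0..capacity Q. ss_weight Q (cutoff_policy K d) i)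
     = (\<Sum>i = 0..K. d ^ i / (\<Prod>j = 1..i. death_rate Q j))"
  using assms by (intro sum.mono_neutral_cong_right) (auto simp: ss_weight_cutoff)

text \<open>Every nonempty state has a weight with a factor \<open>d\<close>. Cancelling it against the \<open>d\<close> in the
  denominator leaves a quotient of polynomials that is continuous up to \<open>d = 0\<close>, where the
  normalizing constant is \<open>1\<close>; so the right limit exists and compactness yields the maximum.\<close>

lemma has_max_lim0_mean_weight:
  assumes "valid_queue Q" and "K \<le> capacity Q"
  shows "\<exists>v. has_max_lim0
      (\<lambda>d. (\<Sum>n = 1..K. w n * ss_prob Q (cutoff_policy K d) n) / (d / max_exit_rate Q))
      (max_arrival Q) v"
proof -
  define D where "D n = (\<Prod>i = 1..n. death_rate Q i)" for n
  define Z where "Z d = (\<Sum>i = 0..K. d ^ i / D i)" for d :: real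
  define G where
    "G d = (\<Sum>n = 1..K. w n * (d ^ (n - 1) / D n)) / Z d * max_exit_rate Q" for d :: real
  let ?f = "\<lambda>d. (\<Sum>n = 1..K. w n * ss_prob Q (cutoff_policy K d) n) / (d / max_exit_rate Q)"
  let ?I = "{0..max_arrival Q}"
  have arr: "0 < max_arrival Q" using assms(1) by (simp add: valid_queue_def)
  have Dpos: "0 < D n" for n
    unfolding D_def by (intro prod_pos) (auto intro: death_rate_pos [OF assms(1)])
  have Zpos: "0 < Z d" if "0 \<le> d" for d
    unfolding Z_def
    by (rule sum_pos2 [of _ 0]) (use that Dpos in \<open>auto intro: divide_nonneg_pos simp: D_def\<close>)
  have cont: "continuous_on ?I G"
    unfolding G_def
    by (intro continuous_intros ballI)
       (use Zpos Dpos in \<open>auto simp: Z_def less_imp_neq [THEN not_sym] intro!: continuous_intros\<close>)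
  have eq: "?f d = G d" if "0 < d" for d
  proof -
    have "(\<Sum>n = 1..K. w n * ss_prob Q (cutoff_policy K d) n)
        = (\<Sum>n = 1..K. d * (w n * (d ^ (n - 1) / D n)) / Z d)"
    proof (intro sum.cong refl)
      fix n assume n: "n \<in> {1..K}"
      have "ss_prob Q (cutoff_policy K d) n = d ^ n / D n / Z d"
        using n unfolding ss_prob_def sum_ss_weight_cutoff [OF assms(2)]
        by (simp add: ss_weight_cutoff D_def Z_def)
      moreover have "d ^ n = d * d ^ (n - 1)"
        using n by (cases n) auto
      ultimately show "w n * ss_prob Q (cutoff_policy K d) n
          = d * (w n * (d ^ (n - 1) / D n)) / Z d"
        by simp
    qed
    also have "\<dots> = d * ((\<Sum>n = 1..K. w n * (d ^ (n - 1) / D n)) / Z d)"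
      by (simp add: sum_divide_distrib sum_distrib_left)
    finally show ?thesis
      using that by (simp add: G_def)
  qed
  have "(G \<longlongrightarrow> G 0) (at 0 within ?I)"
    using cont arr by (simp add: continuous_on_def)
  then have "(G \<longlongrightarrow> G 0) (at_right 0)"
    using arr by (simp add: at_within_Icc_at_right)
  then have lim: "(?f \<longlongrightarrow> G 0) (at_right 0)"
    by (rule Lim_transform_eventually)
       (auto simp: eq [symmetric] intro: eventually_mono [OF eventually_at_right_less])
  have eq0: "(?f(0 := G 0)) d = G d" if "d \<in> ?I" for d
    using that eq by (cases "d = 0") auto
  obtain x where x: "x \<in> ?I" "\<forall>y\<in>?I. G y \<le> G x"
    using continuous_attains_sup [OF _ _ cont] arr by auto
  have "has_max_on (?f(0 := G 0)) ?I (G x)"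
    unfolding has_max_on_def
  proof (intro conjI ballI bexI)
    show "(?f(0 := G 0)) x = G x" using x(1) by (rule eq0)
    show "(?f(0 := G 0)) y \<le> G x" if "y \<in> ?I" for y
      unfolding eq0 [OF that] using x(2) that by (rule bspec)
  qed (rule x(1))
  with lim show ?thesis unfolding has_max_lim0_def by blast
qed

lemma avg_cost_cutoff_le:
  assumes "valid_queue Q" and "K \<le> capacity Q" and "0 \<le> d" and "d \<le> max_arrival Q"
    and "\<And>n. state_cost Q n \<le> c * w n"
  shows "avg_cost Q (cutoff_policy K d)
     \<le> c * (\<Sum>n = 1..K. w n * ss_prob Q (cutoff_policy K d) n)"
proof -
  have adm: "admissible Q (cutoff_policy K d)"
    using admissible_cutoff_policy assms(2-4) by blast
  have "avg_cost Q (cutoff_policy K d)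
      = (\<Sum>n = 1..K. state_cost Q n * ss_prob Q (cutoff_policy K d) n)"
    unfolding avg_cost_def using assms(2)
    by (intro sum.mono_neutral_right) (auto simp: ss_prob_def ss_weight_cutoff)
  also have "\<dots> \<le> (\<Sum>n = 1..K. c * w n * ss_prob Q (cutoff_policy K d) n)"
    using assms(2) by (intro sum_mono mult_right_mono assms(5) ss_prob_nonneg [OF assms(1) adm]) auto
  finally show ?thesis by (simp add: sum_distrib_left mult.assoc)
qed

text \<open>The lower bound on the cost of \<open>p\<close> and the upper bound on the cost of the cutoff-static
  policy differ by the factor that is maximized, taken at the effective arrival rate of \<open>p\<close>.\<close>

lemma avg_cost_cutoff_le_mult_max:
  assumes "valid_queue Q" and "admissible Q p" and "K \<le> capacity Q" and "0 \<le> c"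
    and w: "\<And>n. 0 \<le> w n"
    and lower: "\<And>n. c * real n \<le> state_cost Q n"
    and upper: "\<And>n. state_cost Q n \<le> c * w n"
  shows "\<exists>v. has_max_lim0
        (\<lambda>d. (\<Sum>n = 1..K. w n * ss_prob Q (cutoff_policy K d) n) / (d / max_exit_rate Q))
        (max_arrival Q) v \<and>
      avg_cost Q (cutoff_policy K (eff_arrival Q p)) \<le> avg_cost Q p * v"
proof -
  let ?S = "\<lambda>d. \<Sum>n = 1..K. w n * ss_prob Q (cutoff_policy K d) n"
  let ?f = "\<lambda>d. ?S d / (d / max_exit_rate Q)"
  let ?d = "eff_arrival Q p"
  let ?M = "max_exit_rate Q"
  obtain v where v: "has_max_lim0 ?f (max_arrival Q) v"
    using has_max_lim0_mean_weight [OF assms(1,3)] by blast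
  have f_le: "?f d \<le> v" if "0 < d" "d \<le> max_arrival Q" for d
  proof -
    obtain L where "\<forall>x\<in>{0..max_arrival Q}. (?f(0 := L)) x \<le> v"
      using v unfolding has_max_lim0_def has_max_on_def by blast
    from bspec [OF this, of d] show ?thesis using that by simp
  qed
  have arr: "0 < max_arrival Q" using assms(1) by (simp add: valid_queue_def)
  have M: "0 < ?M" by (rule max_exit_rate_pos [OF assms(1)])
  note d = eff_arrival_bounds [OF assms(1,2)]
  have "0 \<le> ?S d" if "0 \<le> d" "d \<le> max_arrival Q" for d
    using assms(3) that
    by (intro sum_nonneg mult_nonneg_nonneg w
          ss_prob_nonneg [OF assms(1) admissible_cutoff_policy]) auto
  then have "0 \<le> ?f (max_arrival Q)" using arr M by simp
  then have v0: "0 \<le> v" using f_le [of "max_arrival Q"] arr by linarith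
  have "avg_cost Q (cutoff_policy K ?d) \<le> c * (?d / ?M) * v"
  proof (cases "?d = 0")
    case True
    have "avg_cost Q (cutoff_policy K ?d) = 0"
      unfolding avg_cost_def True
      by (intro sum.neutral) (auto simp: ss_prob_def ss_weight_cutoff)
    then show ?thesis using True by simp
  next
    case False
    then have pos: "0 < ?d" using d(1) by linarith
    have "avg_cost Q (cutoff_policy K ?d) \<le> c * ?S ?d"
      by (rule avg_cost_cutoff_le [OF assms(1,3) d upper])
    also have "\<dots> = c * (?d / ?M) * ?f ?d" using pos M by simp
    also have "\<dots> \<le> c * (?d / ?M) * v"
      using pos M assms(4) by (intro mult_left_mono f_le d(2)) auto
    finally show ?thesis .
  qed
  also have "\<dots> \<le> avg_cost Q p * v"
    using v0 by (intro mult_right_mono avg_cost_ge_eff_arrival [OF assms(1,2,4) lower])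
  finally show ?thesis using v by blast
qed

section \<open>The two orderings of the abandonment costs\<close>

theorem theorem5p3:
  fixes Q :: queue and g :: real and h :: "nat \<Rightarrow> real" and K :: nat
  assumes "valid_queue Q"
    and "bellman_solution Q g h"
    and "servers Q \<le> K" and "K \<le> capacity Q"
  shows
    "(aban_cost_q Q * aban_rate_q Q \<ge> aban_cost_s Q * aban_rate_s Q \<and>
      aban_cost_s Q * aban_rate_s Q > 0 \<longrightarrow>
      (\<exists>v. has_max_lim0
             (\<lambda>\<delta>. (\<Sum>n = 1..K. real n * ss_prob Q (cutoff_policy K \<delta>) n) / (\<delta> / max_exit_rate Q)
                + (aban_cost_q Q * aban_rate_q Q - aban_cost_s Q * aban_rate_s Q)
                    / (hold_cost Q + aban_cost_s Q * aban_rate_s Q)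
                  * ((\<Sum>n = servers Q + 1..K. real n * ss_prob Q (cutoff_policy K \<delta>) n)
                      / (\<delta> / max_exit_rate Q)))
             (max_arrival Q) v \<and>
           avg_cost Q (cutoff_policy K (eff_arrival Q (opt_policy Q h)))
             \<le> avg_cost Q (opt_policy Q h) * v)) \<and>
     (aban_cost_s Q * aban_rate_s Q \<ge> aban_cost_q Q * aban_rate_q Q \<and>
      aban_cost_q Q * aban_rate_q Q > 0 \<longrightarrow>
      (\<exists>v. has_max_lim0
             (\<lambda>\<delta>. (\<Sum>n = 1..K. real n * ss_prob Q (cutoff_policy K \<delta>) n) / (\<delta> / max_exit_rate Q)
                + (aban_cost_s Q * aban_rate_s Q - aban_cost_q Q * aban_rate_q Q)
                    / (hold_cost Q + aban_cost_q Q * aban_rate_q Q)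
                  * ((\<Sum>n = 1..K. real (min n (servers Q)) * ss_prob Q (cutoff_policy K \<delta>) n)
                      / (\<delta> / max_exit_rate Q)))
             (max_arrival Q) v \<and>
           avg_cost Q (cutoff_policy K (eff_arrival Q (opt_policy Q h)))
             \<le> avg_cost Q (opt_policy Q h) * v))"
proof -
  let ?p = "opt_policy Q h"
  let ?P = "\<lambda>d. ss_prob Q (cutoff_policy K d)"
  let ?M = "max_exit_rate Q"
  let ?s = "aban_cost_s Q * aban_rate_s Q"
  let ?q = "aban_cost_q Q * aban_rate_q Q"
  let ?e = "\<lambda>n. max (real n - real (servers Q)) 0"
  have adm: "admissible Q ?p"
    using assms(1,2) by (rule admissible_opt_policy)
  have hold: "0 \<le> hold_cost Q" using assms(1) by (simp add: valid_queue_def)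
  have cost: "state_cost Q n = real n * hold_cost Q + real (min n (servers Q)) * ?s + ?e n * ?q" for n
    by (simp add: state_cost_def)
  have excess: "?e n = real n - real (min n (servers Q))" for n
    using min_plus_excess [of n "servers Q"] by linarith
  show ?thesis
  proof (intro conjI impI; elim conjE)
    assume le: "?q \<ge> ?s" and pos: "?s > 0"
    define c where "c = hold_cost Q + ?s"
    have c: "0 < c" using hold pos by (simp add: c_def)
    define w where
      "w n = real n + (?q - ?s) / c * (if servers Q + 1 \<le> n then real n else 0)" for n
    \<comment> \<open>Charge \<open>?s\<close> to every customer and the excess \<open>?q - ?s\<close> to those who wait.\<close>
    have cost': "state_cost Q n = c * real n + (?q - ?s) * ?e n" for n
      unfolding cost excess c_def by (simp add: algebra_simps)
    have "?e n \<le> (if servers Q + 1 \<le> n then real n else 0)" for n by auto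
    then have "(?q - ?s) * ?e n \<le> (?q - ?s) * (if servers Q + 1 \<le> n then real n else 0)" for n
      using le by (intro mult_left_mono) auto
    then have upper: "state_cost Q n \<le> c * w n" for n
      unfolding cost' w_def using c by (simp add: distrib_left)
    have w: "0 \<le> w n" for n
      unfolding w_def using c le by auto
    have lower: "c * real n \<le> state_cost Q n" for n
      unfolding cost' using le by simp
    have sums: "(\<Sum>n = 1..K. w n * ?P d n)
        = (\<Sum>n = 1..K. real n * ?P d n)
          + (?q - ?s) / c * (\<Sum>n = servers Q + 1..K. real n * ?P d n)" for d
    proof -
      have "(\<Sum>n = servers Q + 1..K. real n * ?P d n)
          = (\<Sum>n = 1..K. (if servers Q + 1 \<le> n then real n else 0) * ?P d n)"
        by (intro sum.mono_neutral_cong_left) auto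
      then show ?thesis
        by (simp only: w_def distrib_right sum.distrib sum_distrib_left mult.assoc)
    qed
    have ratio: "(\<Sum>n = 1..K. w n * ?P d n) / (d / ?M)
        = (\<Sum>n = 1..K. real n * ?P d n) / (d / ?M)
          + (?q - ?s) / c * ((\<Sum>n = servers Q + 1..K. real n * ?P d n) / (d / ?M))" for d
      by (simp only: sums add_divide_distrib times_divide_eq_right)
    show "\<exists>v. has_max_lim0
        (\<lambda>d. (\<Sum>n = 1..K. real n * ?P d n) / (d / ?M)
          + (?q - ?s) / (hold_cost Q + ?s)
            * ((\<Sum>n = servers Q + 1..K. real n * ?P d n) / (d / ?M)))
        (max_arrival Q) v \<and>
        avg_cost Q (cutoff_policy K (eff_arrival Q ?p)) \<le> avg_cost Q ?p * v"
      using avg_cost_cutoff_le_mult_max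
        [OF assms(1) adm assms(4) less_imp_le [OF c] w lower upper]
      by (simp only: ratio c_def [symmetric])
  next
    assume le: "?s \<ge> ?q" and pos: "?q > 0"
    define c where "c = hold_cost Q + ?q"
    have c: "0 < c" using hold pos by (simp add: c_def)
    define w where "w n = real n + (?s - ?q) / c * real (min n (servers Q))" for n
    \<comment> \<open>Charge \<open>?q\<close> to every customer and the excess \<open>?s - ?q\<close> to those in service.\<close>
    have cost': "state_cost Q n = c * real n + (?s - ?q) * real (min n (servers Q))" for n
      unfolding cost excess c_def by (simp add: algebra_simps)
    then have upper: "state_cost Q n \<le> c * w n" for n
      unfolding w_def using c by (simp add: distrib_left)
    have w: "0 \<le> w n" for n
      unfolding w_def using c le by auto
    have lower: "c * real n \<le> state_cost Q n" for n
      unfolding cost' using le by simp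
    have sums: "(\<Sum>n = 1..K. w n * ?P d n)
        = (\<Sum>n = 1..K. real n * ?P d n)
          + (?s - ?q) / c * (\<Sum>n = 1..K. real (min n (servers Q)) * ?P d n)" for d
      by (simp only: w_def distrib_right sum.distrib sum_distrib_left mult.assoc)
    have ratio: "(\<Sum>n = 1..K. w n * ?P d n) / (d / ?M)
        = (\<Sum>n = 1..K. real n * ?P d n) / (d / ?M)
          + (?s - ?q) / c * ((\<Sum>n = 1..K. real (min n (servers Q)) * ?P d n) / (d / ?M))" for d
      by (simp only: sums add_divide_distrib times_divide_eq_right)
    show "\<exists>v. has_max_lim0
        (\<lambda>d. (\<Sum>n = 1..K. real n * ?P d n) / (d / ?M)
          + (?s - ?q) / (hold_cost Q + ?q)
            * ((\<Sum>n = 1..K. real (min n (servers Q)) * ?P d n) / (d / ?M)))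
        (max_arrival Q) v \<and>
        avg_cost Q (cutoff_policy K (eff_arrival Q ?p)) \<le> avg_cost Q ?p * v"
      using avg_cost_cutoff_le_mult_max
        [OF assms(1) adm assms(4) less_imp_le [OF c] w lower upper]
      by (simp only: ratio c_def [symmetric])
  qed
qed

end
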